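(* Let $(D_\lambda)_{\lambda\in\Lambda}$ be a family of integral domains and $R=\prod_{\lambda\in\Lambda}D_\lambda$. (1) For every prime ideal $\mathfrak{P}$ of $R$ there exists an ultrafilter $\mathcal{U}$ in $\mathcal{B}=\prod_{\lambda\in\Lambda}\mathcal{P}(\max(D_\lambda))$ such that $\mathfrak{P}\subseteq(\mathcal{U})$. (2) Every prime ideal $\mathfrak{P}$ of $R$ contains a unique minimal prime ideal of $R$. It is equal to $(0)_{\mathcal{F}_{\mathcal{U}}}$ for every ultrafilter $\mathcal{U}$ in $\mathcal{B}$ such that $\mathfrak{P}\subseteq(\mathcal{U})$. In particular, for every prime ideal $\mathfrak{P}$ of $R$ there exists an ultrafilter $\mathcal{U}$ in $\mathcal{B}$ such that \[(0)_{\mathcal{F}_{\mathcal{U}}}\subseteq\mathfrak{P}\subseteq(\mathcal{U}).\]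
   Context: For a commutative ring $D$ with identity, $\max(D)$ is the set of maximal ideals of $D$ and, for $a\in D$, $\mathscr{V}(a)=\{M\in\max(D)\mid a\in M\}$. $\mathcal{B}$ carries the componentwise Boolean operations (least element $(\emptyset)_\lambda$; $Y\le Z$ iff $Y_\lambda\subseteq Z_\lambda$ for all $\lambda$); an ultrafilter in $\mathcal{B}$ is a maximal proper filter. For $a=(a_\lambda)\in R$, $S(a)=(\mathscr{V}(a_\lambda))_{\lambda\in\Lambda}\in\mathcal{B}$, and $(\mathcal{U})=\{a\in R\mid S(a)\in\mathcal{U}\}$. For an ultrafilter $\mathcal{U}$ in $\mathcal{B}$ and $Y\in\mathcal{U}$ let $F_Y=\{\lambda\in\Lambda\mid Y_\lambda\neq\emptyset\}$; then $\mathcal{F}_{\mathcal{U}}=\{F_Y\mid Y\in\mathcal{U}\}$, which is an ultrafilter on $\Lambda$. For an ultrafilter $\mathcal{F}$ on $\Lambda$, $(0)_{\mathcal{F}}=\{x\in R\mid\{\lambda\in\Lambda\mid x_\lambda=0\}\in\mathcal{F}\}$. *)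

theory Defs
  imports "HOL-Algebra.Algebra"
begin

definition product_ring :: "'i set \<Rightarrow> ('i \<Rightarrow> ('a, 'm) ring_scheme) \<Rightarrow> ('i \<Rightarrow> 'a) ring"
  where "product_ring I D =
    \<lparr>carrier = (\<Pi>\<^sub>E i\<in>I. carrier (D i)),
     monoid.mult = (\<lambda>x y. \<lambda>i\<in>I. x i \<otimes>\<^bsub>D i\<^esub> y i),
     one = (\<lambda>i\<in>I. \<one>\<^bsub>D i\<^esub>),
     ring.zero = (\<lambda>i\<in>I. \<zero>\<^bsub>D i\<^esub>),
     ring.add = (\<lambda>x y. \<lambda>i\<in>I. x i \<oplus>\<^bsub>D i\<^esub> y i)\<rparr>"

lemma product_ring_simps [simp]:
  "carrier (product_ring I D) = (\<Pi>\<^sub>E i\<in>I. carrier (D i))"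
  "x \<otimes>\<^bsub>product_ring I D\<^esub> y = (\<lambda>i\<in>I. x i \<otimes>\<^bsub>D i\<^esub> y i)"
  "\<one>\<^bsub>product_ring I D\<^esub> = (\<lambda>i\<in>I. \<one>\<^bsub>D i\<^esub>)"
  "\<zero>\<^bsub>product_ring I D\<^esub> = (\<lambda>i\<in>I. \<zero>\<^bsub>D i\<^esub>)"
  "x \<oplus>\<^bsub>product_ring I D\<^esub> y = (\<lambda>i\<in>I. x i \<oplus>\<^bsub>D i\<^esub> y i)"
  by (simp_all add: product_ring_def)

lemma product_ring_cring:
  fixes I :: "'i set" and D :: "'i \<Rightarrow> ('a, 'm) ring_scheme"
  assumes "\<And>i. i \<in> I \<Longrightarrow> cring (D i)"
  shows "cring (product_ring I D)"
proof (rule cringI)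
  note simps = cring.cring_simprules[OF assms]
    monoid.r_one[OF ring.is_monoid[OF cring.axioms(1)[OF assms]]]
  have ext: "x = y" if "x \<in> extensional I" "y \<in> extensional I" "\<And>i. i \<in> I \<Longrightarrow> x i = y i"
    for x y :: "'i \<Rightarrow> 'a"
    using that by (rule extensionalityI)
  show "abelian_group (product_ring I D)"
  proof (rule abelian_groupI)
    fix x assume "x \<in> carrier (product_ring I D)"
    then show "\<exists>y\<in>carrier (product_ring I D).
        y \<oplus>\<^bsub>product_ring I D\<^esub> x = \<zero>\<^bsub>product_ring I D\<^esub>"
      by (intro bexI[of _ "\<lambda>i\<in>I. \<ominus>\<^bsub>D i\<^esub> x i"]) (auto simp: PiE_iff simps intro!: ext)
  qed (auto simp: PiE_iff simps intro!: ext)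
  show "comm_monoid (product_ring I D)"
    by (rule comm_monoidI) (auto simp: PiE_iff simps intro!: ext)
qed (auto simp: PiE_iff simps(1,5) cring.cring_simprules(13)[OF assms] intro!: ext)

definition max_ideals :: "('a, 'm) ring_scheme \<Rightarrow> 'a set set"
  where "max_ideals D = {M. maximalideal M D}"

definition vanishing :: "('a, 'm) ring_scheme \<Rightarrow> 'a \<Rightarrow> 'a set set"
  where "vanishing D a = {M \<in> max_ideals D. a \<in> M}"

definition max_set_product :: "'i set \<Rightarrow> ('i \<Rightarrow> ('a, 'm) ring_scheme) \<Rightarrow> ('i \<Rightarrow> 'a set set) set"
  where "max_set_product I D = (\<Pi>\<^sub>E i\<in>I. Pow (max_ideals (D i)))"

text \<open>
  Filters in the Boolean algebra \<^term>\<open>max_set_product I D\<close>: meets are componentwise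
  intersections, the order is componentwise inclusion, and properness means that the least
  element, which is constantly empty on \<open>I\<close>, is excluded.
\<close>

definition proper_filter_in ::
    "'i set \<Rightarrow> ('i \<Rightarrow> ('a, 'm) ring_scheme) \<Rightarrow> ('i \<Rightarrow> 'a set set) set \<Rightarrow> bool"
  where "proper_filter_in I D U \<longleftrightarrow>
    U \<subseteq> max_set_product I D \<and> U \<noteq> {} \<and> (\<lambda>i\<in>I. {}) \<notin> U \<and>
    (\<forall>Y\<in>U. \<forall>Z\<in>U. (\<lambda>i\<in>I. Y i \<inter> Z i) \<in> U) \<and>
    (\<forall>Y\<in>U. \<forall>Z\<in>max_set_product I D. (\<forall>i\<in>I. Y i \<subseteq> Z i) \<longrightarrow> Z \<in> U)"

definition ultrafilter_in ::
    "'i set \<Rightarrow> ('i \<Rightarrow> ('a, 'm) ring_scheme) \<Rightarrow> ('i \<Rightarrow> 'a set set) set \<Rightarrow> bool"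
  where "ultrafilter_in I D U \<longleftrightarrow>
    proper_filter_in I D U \<and> (\<forall>V. proper_filter_in I D V \<and> U \<subseteq> V \<longrightarrow> V = U)"

definition vanishing_tuple ::
    "'i set \<Rightarrow> ('i \<Rightarrow> ('a, 'm) ring_scheme) \<Rightarrow> ('i \<Rightarrow> 'a) \<Rightarrow> ('i \<Rightarrow> 'a set set)"
  where "vanishing_tuple I D a = (\<lambda>i\<in>I. vanishing (D i) (a i))"

text \<open>The ideal written $(\mathcal{U})$.\<close>

definition ultrafilter_ideal ::
    "'i set \<Rightarrow> ('i \<Rightarrow> ('a, 'm) ring_scheme) \<Rightarrow> ('i \<Rightarrow> 'a set set) set \<Rightarrow> ('i \<Rightarrow> 'a) set"
  where "ultrafilter_ideal I D U =
    {a \<in> carrier (product_ring I D). vanishing_tuple I D a \<in> U}"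

text \<open>The ultrafilter $\mathcal{F}_{\mathcal{U}}$ on the index set.\<close>

definition index_filter :: "'i set \<Rightarrow> ('i \<Rightarrow> 'a set set) set \<Rightarrow> 'i set set"
  where "index_filter I U = (\<lambda>Y. {i \<in> I. Y i \<noteq> {}}) ` U"

text \<open>The ideal written $(0)_{\mathcal{F}}$.\<close>

definition zero_filter_ideal ::
    "'i set \<Rightarrow> ('i \<Rightarrow> ('a, 'm) ring_scheme) \<Rightarrow> 'i set set \<Rightarrow> ('i \<Rightarrow> 'a) set"
  where "zero_filter_ideal I D F =
    {x \<in> carrier (product_ring I D). {i \<in> I. x i = \<zero>\<^bsub>D i\<^esub>} \<in> F}"

definition minimal_primeideal :: "'b set \<Rightarrow> ('b, 'm) ring_scheme \<Rightarrow> bool"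
  where "minimal_primeideal Q R \<longleftrightarrow>
    primeideal Q R \<and> (\<forall>Q'. primeideal Q' R \<and> Q' \<subseteq> Q \<longrightarrow> Q' = Q)"

end

theory Submission
  imports Defs
begin

text \<open>
  For a prime \<open>P\<close> of the product the idempotents contained in \<open>P\<close> define an ultrafilter \<open>F P\<close> on
  the index set with \<open>(0)\<^bsub>F P\<^esub> \<subseteq> P\<close>. Inclusion of primes \<open>Q \<subseteq> P\<close> forces \<open>F Q = F P\<close>, so
  \<open>(0)\<^bsub>F P\<^esub>\<close> is the least prime below \<open>P\<close>. If \<open>P \<subseteq> (U)\<close>, the vanishing tuples of
  the idempotents in \<open>P\<close> show that \<open>F P\<close> coincides with the index filter of \<open>U\<close>.
  The ultrafilter \<open>U\<close> itself is obtained by extending the filter of all tuples that contain the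
  zero loci of some family of ideals \<open>J\<^sub>i\<close> with \<open>\<Prod>\<^sub>i J\<^sub>i \<subseteq> P\<close>. Such families are closed
  under sums, and an empty zero locus means \<open>J\<^sub>i = D\<^sub>i\<close> for all \<open>i\<close>, that is \<open>1 \<in> P\<close>.
\<close>

section \<open>Zorn's lemma for maximal ideals and for ultrafilters\<close>

lemma (in ring) ex_maximalideal_above:
  assumes "ideal J R" "J \<noteq> carrier R"
  shows "\<exists>M. maximalideal M R \<and> J \<subseteq> M"
proof -
  let ?A = "{K. ideal K R \<and> K \<noteq> carrier R \<and> J \<subseteq> K}"
  have "\<exists>M\<in>?A. \<forall>N\<in>?A. M \<subseteq> N \<longrightarrow> N = M"
  proof (rule subset_Zorn_nonempty)
    show "?A \<noteq> {}" using assms by blast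
    fix C assume C: "C \<noteq> {}" "subset.chain ?A C"
    then have mem: "\<And>K. K \<in> C \<Longrightarrow> ideal K R \<and> K \<noteq> carrier R \<and> J \<subseteq> K"
      by (auto simp: subset.chain_def)
    have "subset.chain {K. ideal K R} C"
      using C(2) by (auto simp: subset.chain_def)
    with C(1) have "ideal (\<Union>C) R"
      using chain_Union_is_ideal[of C] by simp
    \<comment> \<open>Properness survives the union because it is tested on the single element
      one.\<close>
    moreover have "\<one> \<notin> \<Union>C"
      using mem ideal.one_imp_carrier by blast
    moreover have "J \<subseteq> \<Union>C"
      using mem C(1) by blast
    ultimately show "\<Union>C \<in> ?A" by auto
  qed
  then obtain M where M: "ideal M R" "M \<noteq> carrier R" "J \<subseteq> M"
    and max: "\<forall>N\<in>?A. M \<subseteq> N \<longrightarrow> N = M"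
    by (elim bexE CollectE conjE)
  have "maximalideal M R"
  proof (rule maximalidealI)
    fix N assume "ideal N R" "M \<subseteq> N"
    then show "N = M \<or> N = carrier R" using max M(3) by auto
  qed (use M in auto)
  with M(3) show ?thesis by blast
qed

text \<open>Two members of the union already lie in a common filter of the chain, which contains
  their meet; the other conditions concern one member at a time.\<close>

lemma proper_filter_in_Union_chain:
  assumes "C \<noteq> {}" "subset.chain {V. proper_filter_in I D V} C"
  shows "proper_filter_in I D (\<Union>C)"
proof -
  have mem: "V \<subseteq> max_set_product I D" "V \<noteq> {}" "(\<lambda>i\<in>I. {}) \<notin> V"
      "\<And>Y Z. Y \<in> V \<Longrightarrow> Z \<in> V \<Longrightarrow> (\<lambda>i\<in>I. Y i \<inter> Z i) \<in> V"
      "\<And>Y Z. Y \<in> V \<Longrightarrow> Z \<in> max_set_product I D \<Longrightarrow> \<forall>i\<in>I. Y i \<subseteq> Z i \<Longrightarrow> Z \<in> V"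
    if "V \<in> C" for V
    using that assms(2) by (auto simp: subset.chain_def proper_filter_in_def)
  have meet: "(\<lambda>i\<in>I. Y i \<inter> Z i) \<in> \<Union>C" if Y: "Y \<in> \<Union>C" and Z: "Z \<in> \<Union>C" for Y Z
  proof -
    from Y Z obtain V W where VW: "Y \<in> V" "V \<in> C" "Z \<in> W" "W \<in> C" by blast
    then have "V \<subseteq> W \<or> W \<subseteq> V"
      using assms(2) by (auto simp: subset.chain_def)
    then obtain T where "T \<in> C" "Y \<in> T" "Z \<in> T" using VW by blast
    then show ?thesis using mem(4) by blast
  qed
  have sup: "Z \<in> \<Union>C"
    if "Y \<in> \<Union>C" "Z \<in> max_set_product I D" "\<forall>i\<in>I. Y i \<subseteq> Z i" for Y Z
    using that mem(5) by blast
  have "\<Union>C \<subseteq> max_set_product I D" "\<Union>C \<noteq> {}" "(\<lambda>i\<in>I. {}) \<notin> \<Union>C"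
    using mem(1-3) assms(1) by blast+
  with meet sup show ?thesis
    unfolding proper_filter_in_def by blast
qed

lemma ex_ultrafilter_in_above:
  assumes "proper_filter_in I D V"
  shows "\<exists>U. ultrafilter_in I D U \<and> V \<subseteq> U"
proof -
  let ?A = "{W. proper_filter_in I D W \<and> V \<subseteq> W}"
  have "\<exists>M\<in>?A. \<forall>N\<in>?A. M \<subseteq> N \<longrightarrow> N = M"
  proof (rule subset_Zorn_nonempty)
    show "?A \<noteq> {}" using assms by blast
    fix C assume C: "C \<noteq> {}" "subset.chain ?A C"
    then have "subset.chain {W. proper_filter_in I D W} C"
      by (auto simp: subset.chain_def)
    with C(1) have "proper_filter_in I D (\<Union>C)"
      by (rule proper_filter_in_Union_chain)
    moreover have "V \<subseteq> \<Union>C"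
      using C unfolding subset.chain_def by blast
    ultimately show "\<Union>C \<in> ?A" by simp
  qed
  then obtain U where "proper_filter_in I D U" "V \<subseteq> U"
    and max: "\<forall>N\<in>?A. U \<subseteq> N \<longrightarrow> N = U"
    by (elim bexE CollectE conjE)
  \<comment> \<open>A proper filter containing \<open>U\<close> also contains \<open>V\<close>, so
    maximality above \<open>V\<close> is maximality among all proper filters.\<close>
  then have "ultrafilter_in I D U" by (auto simp: ultrafilter_in_def)
  with \<open>V \<subseteq> U\<close> show ?thesis by blast
qed

section \<open>Idempotents of the product\<close>

definition product_idempotent :: "'i set \<Rightarrow> ('i \<Rightarrow> ('a, 'm) ring_scheme) \<Rightarrow> 'i set \<Rightarrow> 'i \<Rightarrow> 'a"
  where "product_idempotent I D A = (\<lambda>i\<in>I. if i \<in> A then \<one>\<^bsub>D i\<^esub> else \<zero>\<^bsub>D i\<^esub>)"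

text \<open>The complement makes \<open>A\<close> the zero set of the idempotent: over domains, the
  members are exactly the zero sets of idempotents lying in \<open>P\<close>.\<close>

definition prime_index_filter ::
    "'i set \<Rightarrow> ('i \<Rightarrow> ('a, 'm) ring_scheme) \<Rightarrow> ('i \<Rightarrow> 'a) set \<Rightarrow> 'i set set"
  where "prime_index_filter I D P = {A. A \<subseteq> I \<and> product_idempotent I D (I - A) \<in> P}"

locale domain_family =
  fixes I :: "'i set" and D :: "'i \<Rightarrow> ('a, 'm) ring_scheme"
  assumes domain_component: "\<And>i. i \<in> I \<Longrightarrow> domain (D i)"
begin

abbreviation R where "R \<equiv> product_ring I D"
abbreviation e where "e \<equiv> product_idempotent I D"
abbreviation F where "F \<equiv> prime_index_filter I D"

lemma cring_component: "i \<in> I \<Longrightarrow> cring (D i)"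
  using domain_component by (simp add: domain_def)

lemma ring_component: "i \<in> I \<Longrightarrow> ring (D i)"
  using cring_component by (simp add: cring_def)

lemma cring_R: "cring R"
  using cring_component by (rule product_ring_cring)

lemma component_closed: "x \<in> carrier R \<Longrightarrow> i \<in> I \<Longrightarrow> x i \<in> carrier (D i)"
  by auto

lemma carrier_eqI:
  "x \<in> carrier R \<Longrightarrow> y \<in> carrier R \<Longrightarrow> (\<And>i. i \<in> I \<Longrightarrow> x i = y i) \<Longrightarrow> x = y"
  by (auto simp: PiE_iff intro: extensionalityI)

lemma component_simps:
  assumes "i \<in> I"
  shows "\<zero>\<^bsub>D i\<^esub> \<in> carrier (D i)" "\<one>\<^bsub>D i\<^esub> \<in> carrier (D i)"
    "x \<in> carrier (D i) \<Longrightarrow> \<zero>\<^bsub>D i\<^esub> \<oplus>\<^bsub>D i\<^esub> x = x"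
    "x \<in> carrier (D i) \<Longrightarrow> x \<oplus>\<^bsub>D i\<^esub> \<zero>\<^bsub>D i\<^esub> = x"
    "x \<in> carrier (D i) \<Longrightarrow> \<one>\<^bsub>D i\<^esub> \<otimes>\<^bsub>D i\<^esub> x = x"
    "x \<in> carrier (D i) \<Longrightarrow> x \<otimes>\<^bsub>D i\<^esub> \<one>\<^bsub>D i\<^esub> = x"
    "x \<in> carrier (D i) \<Longrightarrow> \<zero>\<^bsub>D i\<^esub> \<otimes>\<^bsub>D i\<^esub> x = \<zero>\<^bsub>D i\<^esub>"
    "x \<in> carrier (D i) \<Longrightarrow> x \<otimes>\<^bsub>D i\<^esub> \<zero>\<^bsub>D i\<^esub> = \<zero>\<^bsub>D i\<^esub>"
proof -
  interpret domain "D i" using assms by (rule domain_component)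
  show "\<zero>\<^bsub>D i\<^esub> \<in> carrier (D i)" "\<one>\<^bsub>D i\<^esub> \<in> carrier (D i)"
    "x \<in> carrier (D i) \<Longrightarrow> \<zero>\<^bsub>D i\<^esub> \<oplus>\<^bsub>D i\<^esub> x = x"
    "x \<in> carrier (D i) \<Longrightarrow> x \<oplus>\<^bsub>D i\<^esub> \<zero>\<^bsub>D i\<^esub> = x"
    "x \<in> carrier (D i) \<Longrightarrow> \<one>\<^bsub>D i\<^esub> \<otimes>\<^bsub>D i\<^esub> x = x"
    "x \<in> carrier (D i) \<Longrightarrow> x \<otimes>\<^bsub>D i\<^esub> \<one>\<^bsub>D i\<^esub> = x"
    "x \<in> carrier (D i) \<Longrightarrow> \<zero>\<^bsub>D i\<^esub> \<otimes>\<^bsub>D i\<^esub> x = \<zero>\<^bsub>D i\<^esub>"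
    "x \<in> carrier (D i) \<Longrightarrow> x \<otimes>\<^bsub>D i\<^esub> \<zero>\<^bsub>D i\<^esub> = \<zero>\<^bsub>D i\<^esub>"
    by simp_all
qed

lemma e_closed: "e A \<in> carrier R"
  by (auto simp: product_idempotent_def component_simps)

lemma e_apply: "i \<in> I \<Longrightarrow> e A i = (if i \<in> A then \<one>\<^bsub>D i\<^esub> else \<zero>\<^bsub>D i\<^esub>)"
  by (simp add: product_idempotent_def)

lemma e_mult: "e A \<otimes>\<^bsub>R\<^esub> e B = e (A \<inter> B)"
  by (auto simp: product_idempotent_def fun_eq_iff component_simps)

lemma e_add_compl: "e A \<oplus>\<^bsub>R\<^esub> e (I - A) = \<one>\<^bsub>R\<^esub>"
  by (auto simp: product_idempotent_def fun_eq_iff component_simps)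

lemma prime_one_notin: "primeideal P R \<Longrightarrow> \<one>\<^bsub>R\<^esub> \<notin> P"
  using primeideal.I_notcarr ideal.one_imp_carrier primeideal.axioms(1) by metis

section \<open>The ultrafilter on the index set attached to a prime, and its prime ideal\<close>

context
  fixes P assumes P: "primeideal P R"
begin

interpretation primeideal P R by (rule P)

text \<open>The two idempotents have sum one, so \<open>P\<close> cannot contain both, and product
  zero, so the prime \<open>P\<close> contains at least one.\<close>

lemma e_mem_prime_compl: "e (I - A) \<in> P \<longleftrightarrow> e A \<notin> P"
proof
  assume compl: "e (I - A) \<in> P"
  show "e A \<notin> P"
  proof
    assume "e A \<in> P"
    then have "e A \<oplus>\<^bsub>R\<^esub> e (I - A) \<in> P"
      using compl by (rule additive_subgroup.a_closed[OF is_additive_subgroup])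
    then show False
      using prime_one_notin[OF P] by (simp only: e_add_compl)
  qed
next
  have "e {} = \<zero>\<^bsub>R\<^esub>"
    by (simp add: product_idempotent_def fun_eq_iff)
  then have "e A \<otimes>\<^bsub>R\<^esub> e (I - A) \<in> P"
    using additive_subgroup.zero_closed[OF is_additive_subgroup] e_mult[of A "I - A"]
    by (simp del: product_ring_simps)
  then show "e A \<notin> P \<Longrightarrow> e (I - A) \<in> P"
    using I_prime e_closed by blast
qed

lemma e_mem_prime_subset: "A \<subseteq> B \<Longrightarrow> e B \<in> P \<Longrightarrow> e A \<in> P"
  using I_l_closed[OF _ e_closed, of "e B" A] by (simp add: e_mult Int_absorb2 del: product_ring_simps)

lemma prime_index_filter_compl: "A \<subseteq> I \<Longrightarrow> I - A \<in> F P \<longleftrightarrow> A \<notin> F P"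
  using e_mem_prime_compl[of A] by (simp add: prime_index_filter_def double_diff)

lemma prime_index_filter_superset: "A \<in> F P \<Longrightarrow> A \<subseteq> B \<Longrightarrow> B \<subseteq> I \<Longrightarrow> B \<in> F P"
  using e_mem_prime_subset[of "I - B" "I - A"] by (auto simp: prime_index_filter_def)

text \<open>Complements turn the union into a product of idempotents, to which primality of
  \<open>P\<close> applies.\<close>

lemma prime_index_filter_Un:
  assumes "A \<union> B \<in> F P" shows "A \<in> F P \<or> B \<in> F P"
proof -
  have "e (I - A) \<otimes>\<^bsub>R\<^esub> e (I - B) \<in> P"
    using assms by (simp add: prime_index_filter_def e_mult Diff_Un del: product_ring_simps)
  then show ?thesis
    using assms I_prime e_closed by (auto simp: prime_index_filter_def)
qed

text \<open>De Morgan dual of the union property, since exactly one of a set and its complement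
  belongs to \<open>F P\<close>.\<close>

lemma prime_index_filter_Int:
  assumes "A \<in> F P" "B \<in> F P" shows "A \<inter> B \<in> F P"
proof (rule ccontr)
  have AB: "A \<subseteq> I" "B \<subseteq> I" using assms by (auto simp: prime_index_filter_def)
  assume "A \<inter> B \<notin> F P"
  then have "(I - A) \<union> (I - B) \<in> F P"
    using prime_index_filter_compl[of "A \<inter> B"] AB by (simp add: Diff_Int le_infI1)
  then show False
    using prime_index_filter_Un prime_index_filter_compl AB assms by blast
qed

lemma empty_notin_prime_index_filter: "{} \<notin> F P"
proof
  assume "{} \<in> F P"
  then have "e I \<in> P" by (simp add: prime_index_filter_def)
  moreover have "e I = \<one>\<^bsub>R\<^esub>" by (auto simp: product_idempotent_def fun_eq_iff)
  ultimately show False using prime_one_notin[OF P] by metis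
qed

text \<open>The idempotent supported where \<open>x\<close> is nonzero lies in \<open>P\<close> and
  fixes \<open>x\<close> under multiplication, so \<open>x\<close> is a multiple of a member of
  \<open>P\<close>.\<close>

lemma zero_filter_ideal_subset_prime: "zero_filter_ideal I D (F P) \<subseteq> P"
proof
  fix x assume "x \<in> zero_filter_ideal I D (F P)"
  then have x: "x \<in> carrier R" and Z: "e (I - {i \<in> I. x i = \<zero>\<^bsub>D i\<^esub>}) \<in> P" (is "e ?N \<in> P")
    by (auto simp: zero_filter_ideal_def prime_index_filter_def)
  have "x \<otimes>\<^bsub>R\<^esub> e ?N = x"
    by (rule carrier_eqI)
      (use x e_closed[of ?N] in \<open>auto simp: e_apply component_simps PiE_iff\<close>)
  then show "x \<in> P" using I_l_closed[OF Z x] by (simp only:)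
qed

text \<open>Ring operations keep common zeros, so the filter laws of \<open>F P\<close> give an
  ideal. Since the components are domains, the zero set of a product is the union of the zero sets,
  and \<open>F P\<close> splits unions; this gives primality.\<close>

lemma zero_filter_ideal_prime: "primeideal (zero_filter_ideal I D (F P)) R" (is "primeideal ?Q R")
proof (rule primeidealI)
  let ?z = "\<lambda>x. {i \<in> I. x i = \<zero>\<^bsub>D i\<^esub>}"
  have Q: "x \<in> ?Q \<longleftrightarrow> x \<in> carrier R \<and> ?z x \<in> F P" for x
    by (simp add: zero_filter_ideal_def)
  have sup: "?z y \<in> F P" if "A \<in> F P" "A \<subseteq> ?z y" for y A
    using that prime_index_filter_superset by blast
  show "cring R" by (rule cring_R)
  show "ideal ?Q R"
  proof (rule idealI)
    show "ring R" using cring_R by (simp add: cring_def)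
    show "subgroup ?Q (add_monoid R)"
    proof (rule add.subgroupI)
      show "?Q \<subseteq> carrier R" by (auto simp: Q)
      have "\<zero>\<^bsub>R\<^esub> \<in> ?Q"
      proof -
        have "I \<in> F P"
          using prime_index_filter_compl[of I] empty_notin_prime_index_filter by auto
        moreover have "?z \<zero>\<^bsub>R\<^esub> = I" by auto
        ultimately show ?thesis unfolding Q using zero_closed by simp
      qed
      then show "?Q \<noteq> {}" by blast
      fix x assume x: "x \<in> ?Q"
      then have xc: "x \<in> carrier R" and zx: "?z x \<in> F P" by (auto simp: Q)
      \<comment> \<open>The inverse in \<open>R\<close> is known only through its sum with
        \<open>x\<close>, so its components are read off from that equation.\<close>
      have "(\<ominus>\<^bsub>R\<^esub> x) i = \<zero>\<^bsub>D i\<^esub>" if "i \<in> ?z x" for i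
      proof -
        have i: "i \<in> I" and xi: "x i = \<zero>\<^bsub>D i\<^esub>" using that by auto
        have "(x \<oplus>\<^bsub>R\<^esub> \<ominus>\<^bsub>R\<^esub> x) i = \<zero>\<^bsub>R\<^esub> i"
          by (simp only: r_neg[OF xc])
        moreover have "(\<ominus>\<^bsub>R\<^esub> x) i \<in> carrier (D i)"
          using component_closed a_inv_closed xc i by blast
        ultimately show ?thesis
          using i xi by (simp add: component_simps)
      qed
      then show "\<ominus>\<^bsub>R\<^esub> x \<in> ?Q"
        unfolding Q using a_inv_closed[OF xc] sup[OF zx] by auto
      fix y assume y: "y \<in> ?Q"
      then have yc: "y \<in> carrier R" and zy: "?z y \<in> F P" by (auto simp: Q)
      have "?z x \<inter> ?z y \<subseteq> ?z (x \<oplus>\<^bsub>R\<^esub> y)"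
        by (auto simp: component_simps)
      then show "x \<oplus>\<^bsub>R\<^esub> y \<in> ?Q"
        unfolding Q using add.m_closed[OF xc yc] sup[OF prime_index_filter_Int[OF zx zy]] by blast
    qed
    fix a x assume "a \<in> ?Q" and x: "x \<in> carrier R"
    then have a: "a \<in> carrier R" and za: "?z a \<in> F P" by (auto simp: Q)
    have "?z a \<subseteq> ?z (x \<otimes>\<^bsub>R\<^esub> a)" "?z a \<subseteq> ?z (a \<otimes>\<^bsub>R\<^esub> x)"
      using component_closed[OF x] by (auto simp: component_simps)
    then show "x \<otimes>\<^bsub>R\<^esub> a \<in> ?Q" "a \<otimes>\<^bsub>R\<^esub> x \<in> ?Q"
      unfolding Q using m_closed[OF x a] m_closed[OF a x] sup[OF za] by blast+
  qed
  show "carrier R \<noteq> ?Q"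
    using zero_filter_ideal_subset_prime prime_one_notin[OF P] one_closed by blast
  fix a b assume a: "a \<in> carrier R" and b: "b \<in> carrier R" and ab: "a \<otimes>\<^bsub>R\<^esub> b \<in> ?Q"
  have "?z (a \<otimes>\<^bsub>R\<^esub> b) = ?z a \<union> ?z b"
    using component_closed[OF a] component_closed[OF b] domain.integral_iff[OF domain_component]
    by auto
  moreover have "?z (a \<otimes>\<^bsub>R\<^esub> b) \<in> F P" using ab Q by blast
  ultimately have "?z a \<union> ?z b \<in> F P" by (simp only:)
  then show "a \<in> ?Q \<or> b \<in> ?Q"
    using prime_index_filter_Un a b Q by blast
qed

end

section \<open>The least prime below a given prime\<close>

lemma prime_index_filter_eq:
  assumes "primeideal Q R" "primeideal P R" "Q \<subseteq> P"
  shows "F Q = F P"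
proof
  show "F Q \<subseteq> F P" using assms(3) by (auto simp: prime_index_filter_def)
  \<comment> \<open>A set in \<open>F P\<close> but not in \<open>F Q\<close> would have its
    complement in \<open>F Q\<close>, hence in \<open>F P\<close> as well.\<close>
  then show "F P \<subseteq> F Q"
    using prime_index_filter_compl[OF assms(1)] prime_index_filter_compl[OF assms(2)]
    by (auto simp: prime_index_filter_def)
qed

text \<open>The ideal depends on the prime only through its index filter, which \<open>P\<close>
  shares with \<open>Q\<close>; so it is also the ideal attached to \<open>Q\<close>.\<close>

lemma zero_filter_ideal_least:
  assumes "primeideal Q R" "primeideal P R" "Q \<subseteq> P"
  shows "zero_filter_ideal I D (F P) \<subseteq> Q"
  using zero_filter_ideal_subset_prime[OF assms(1)] prime_index_filter_eq[OF assms] by simp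

text \<open>A least prime below \<open>P\<close> is the only minimal one there. The equivalence
  delivers existence, uniqueness and the formula at once.\<close>

lemma minimal_primeideal_below_iff:
  assumes "primeideal P R"
  shows "minimal_primeideal Q R \<and> Q \<subseteq> P \<longleftrightarrow> Q = zero_filter_ideal I D (F P)"
proof
  assume "minimal_primeideal Q R \<and> Q \<subseteq> P"
  then show "Q = zero_filter_ideal I D (F P)"
    using zero_filter_ideal_prime[OF assms] zero_filter_ideal_least[OF _ assms]
    by (metis minimal_primeideal_def)
next
  assume "Q = zero_filter_ideal I D (F P)"
  then show "minimal_primeideal Q R \<and> Q \<subseteq> P"
    using zero_filter_ideal_prime[OF assms] zero_filter_ideal_least[OF _ assms]
      zero_filter_ideal_subset_prime[OF assms]
    unfolding minimal_primeideal_def by blast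
qed

section \<open>Comparison with the index filter of an ultrafilter above a prime\<close>

lemma max_ideals_nonempty:
  assumes "i \<in> I" shows "max_ideals (D i) \<noteq> {}"
proof -
  interpret domain "D i" using assms by (rule domain_component)
  have "{\<zero>\<^bsub>D i\<^esub>} \<noteq> carrier (D i)" using carrier_one_not_zero by simp
  then show ?thesis
    using ex_maximalideal_above[OF zeroideal] by (auto simp: max_ideals_def)
qed

lemma vanishing_e:
  assumes "i \<in> I"
  shows "vanishing (D i) (e A i) = (if i \<in> A then {} else max_ideals (D i))"
proof -
  have "\<one>\<^bsub>D i\<^esub> \<notin> M \<and> \<zero>\<^bsub>D i\<^esub> \<in> M" if "maximalideal M (D i)" for M
  proof -
    interpret maximalideal M "D i" by (rule that)
    show ?thesis using one_imp_carrier I_notcarr by auto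
  qed
  then show ?thesis
    using assms by (auto simp: e_apply vanishing_def max_ideals_def)
qed

text \<open>Vanishing tuples of idempotents in \<open>P\<close> give one inclusion. For the other,
  \<open>F P\<close> contains \<open>A\<close> or its complement, while two members of
  \<open>U\<close> with complementary index sets would have the least element as their meet.\<close>

lemma index_filter_eq:
  assumes P: "primeideal P R" and U: "proper_filter_in I D U" and PU: "P \<subseteq> ultrafilter_ideal I D U"
  shows "index_filter I U = F P"
proof
  show FU: "F P \<subseteq> index_filter I U"
  proof
    fix A assume "A \<in> F P"
    then have A: "A \<subseteq> I" and "e (I - A) \<in> P" by (auto simp: prime_index_filter_def)
    then have "vanishing_tuple I D (e (I - A)) \<in> U"
      using PU by (auto simp: ultrafilter_ideal_def)
    \<comment> \<open>The component is all of \<open>max_ideals (D i)\<close> for \<open>i\<close>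
      in \<open>A\<close> and empty on the rest of \<open>I\<close>; nonemptiness of
      \<open>max_ideals (D i)\<close> recovers \<open>A\<close>.\<close>
    moreover have "A = {i \<in> I. vanishing_tuple I D (e (I - A)) i \<noteq> {}}"
      using A max_ideals_nonempty by (auto simp: vanishing_tuple_def vanishing_e)
    ultimately show "A \<in> index_filter I U"
      unfolding index_filter_def by (intro image_eqI)
  qed
  show "index_filter I U \<subseteq> F P"
  proof
    fix A assume "A \<in> index_filter I U"
    then obtain Y where Y: "Y \<in> U" "A = {i \<in> I. Y i \<noteq> {}}" by (auto simp: index_filter_def)
    show "A \<in> F P"
    proof (rule ccontr)
      assume "A \<notin> F P"
      then have "I - A \<in> index_filter I U"
        using prime_index_filter_compl[OF P, of A] FU Y(2) by auto
      then obtain Z where Z: "Z \<in> U" "I - A = {i \<in> I. Z i \<noteq> {}}" by (auto simp: index_filter_def)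
      have "(\<lambda>i\<in>I. Y i \<inter> Z i) \<in> U"
        using U Y Z by (simp add: proper_filter_in_def)
      moreover have "(\<lambda>i\<in>I. Y i \<inter> Z i) = (\<lambda>i\<in>I. {})"
        using Y(2) Z(2) by (intro restrict_ext) blast
      ultimately show False
        using U by (simp add: proper_filter_in_def)
    qed
  qed
qed

section \<open>Existence of an ultrafilter above a prime\<close>

lemma ex_ultrafilter_ideal_above:
  assumes P: "primeideal P R"
  shows "\<exists>U. ultrafilter_in I D U \<and> P \<subseteq> ultrafilter_ideal I D U"
proof -
  interpret primeideal P R by (rule P)
  \<comment> \<open>Two vanishing sets meet in the locus of the ideal generated by both elements,
    which need not be principal. Hence families of ideals replace elements of
    \<open>P\<close>.\<close>
  define adm where "adm J \<longleftrightarrow> (\<forall>i\<in>I. ideal (J i) (D i)) \<and> (\<Pi>\<^sub>E i\<in>I. J i) \<subseteq> P" for J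
  define locus where "locus J i = {M \<in> max_ideals (D i). J i \<subseteq> M}" for J and i
  \<comment> \<open>\<open>locus J\<close> need not be extensional, so it generates \<open>V\<close>
    by comparison on \<open>I\<close> instead of being a member itself.\<close>
  define V where
    "V = {Y \<in> max_set_product I D. \<exists>J. adm J \<and> (\<forall>i\<in>I. locus J i \<subseteq> Y i)}"
  have principal: "adm (\<lambda>i. PIdl\<^bsub>D i\<^esub> (a i))" if a: "a \<in> P" for a
    unfolding adm_def
  proof (intro conjI ballI subsetI)
    fix i assume "i \<in> I"
    then show "ideal (PIdl\<^bsub>D i\<^esub> (a i)) (D i)"
      using cring.cgenideal_ideal[OF cring_component] component_closed[OF Icarr[OF a]] by blast
  next
    fix c assume c: "c \<in> (\<Pi>\<^sub>E i\<in>I. PIdl\<^bsub>D i\<^esub> (a i))"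
    then have "\<forall>i\<in>I. \<exists>r. r \<in> carrier (D i) \<and> c i = r \<otimes>\<^bsub>D i\<^esub> a i"
      by (fastforce simp: cgenideal_def PiE_iff)
    \<comment> \<open>Coefficients chosen in each component assemble into one coefficient in
      \<open>R\<close>: the product of the principal ideals lies in the principal ideal of
      \<open>a\<close>.\<close>
    then obtain r where r: "\<And>i. i \<in> I \<Longrightarrow> r i \<in> carrier (D i) \<and> c i = r i \<otimes>\<^bsub>D i\<^esub> a i"
      by metis
    have "c = restrict r I \<otimes>\<^bsub>R\<^esub> a"
      using c r by (auto simp: PiE_iff intro!: extensionalityI)
    moreover have "restrict r I \<in> carrier R" using r by simp
    ultimately show "c \<in> P" using I_l_closed[OF a] by (simp only:)
  qed
  have sum: "adm (\<lambda>i. J i <+>\<^bsub>D i\<^esub> K i)" if J: "adm J" and K: "adm K" for J K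
    unfolding adm_def
  proof (intro conjI ballI subsetI)
    fix i assume "i \<in> I"
    then show "ideal (J i <+>\<^bsub>D i\<^esub> K i) (D i)"
      using ring.add_ideals[OF ring_component] J K by (simp add: adm_def)
  next
    fix c assume c: "c \<in> (\<Pi>\<^sub>E i\<in>I. J i <+>\<^bsub>D i\<^esub> K i)"
    then have "\<forall>i\<in>I. \<exists>h k. h \<in> J i \<and> k \<in> K i \<and> c i = h \<oplus>\<^bsub>D i\<^esub> k"
      by (fastforce simp: set_add_def' PiE_iff)
    \<comment> \<open>Componentwise choice splits \<open>c\<close> into a sum of one element from
      each of the two products, both contained in \<open>P\<close>.\<close>
    then obtain h k where hk: "\<And>i. i \<in> I \<Longrightarrow> h i \<in> J i \<and> k i \<in> K i \<and> c i = h i \<oplus>\<^bsub>D i\<^esub> k i"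
      by metis
    have "c = restrict h I \<oplus>\<^bsub>R\<^esub> restrict k I"
      using c hk by (auto simp: PiE_iff intro!: extensionalityI)
    moreover have "restrict h I \<in> P" "restrict k I \<in> P"
      using J K hk by (auto simp: adm_def)
    ultimately show "c \<in> P"
      using additive_subgroup.a_closed[OF is_additive_subgroup] by (simp only:)
  qed
  have locus_sum: "locus (\<lambda>i. J i <+>\<^bsub>D i\<^esub> K i) i \<subseteq> locus J i \<inter> locus K i"
    if "adm J" "adm K" "i \<in> I" for J K i
  proof -
    have JK: "ideal (J i) (D i)" "ideal (K i) (D i)" using that by (auto simp: adm_def)
    have "J i \<union> K i \<subseteq> carrier (D i)"
      using ideal.Icarr[OF JK(1)] ideal.Icarr[OF JK(2)] by blast
    \<comment> \<open>The sum is the ideal generated by the union, so a maximal ideal above it lies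
      above both summands.\<close>
    then have "J i \<union> K i \<subseteq> J i <+>\<^bsub>D i\<^esub> K i"
      using ring.union_genideal[OF ring_component[OF that(3)] JK]
        ring.genideal_self[OF ring_component[OF that(3)]] by blast
    then show ?thesis by (auto simp: locus_def)
  qed
  have proper: "\<exists>i\<in>I. locus J i \<noteq> {}" if J: "adm J" for J
  proof (rule ccontr)
    assume "\<not> ?thesis"
    then have "J i = carrier (D i)" if "i \<in> I" for i
      using ring.ex_maximalideal_above[OF ring_component[OF that], of "J i"] J that
      by (auto simp: adm_def locus_def max_ideals_def)
    then have "carrier R \<subseteq> P"
      using J by (simp add: adm_def cong: PiE_cong)
    then show False using prime_one_notin[OF P] one_closed by blast
  qed
  \<comment> \<open>Principal families bring the elements of \<open>P\<close> into \<open>V\<close>;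
    this yields nonemptiness of \<open>V\<close> and later the inclusion of \<open>P\<close> in the
    ideal of \<open>U\<close>.\<close>
  have vanishing_mem: "vanishing_tuple I D a \<in> V" if a: "a \<in> P" for a
  proof -
    have "locus (\<lambda>i. PIdl\<^bsub>D i\<^esub> (a i)) i \<subseteq> vanishing (D i) (a i)" if i: "i \<in> I" for i
      using ring.cgenideal_self[OF ring_component[OF i] component_closed[OF Icarr[OF a] i]]
      by (auto simp: locus_def vanishing_def)
    moreover have "vanishing_tuple I D a \<in> max_set_product I D"
      by (auto simp: vanishing_tuple_def max_set_product_def vanishing_def)
    ultimately show ?thesis
      using principal[OF a] by (auto simp: V_def vanishing_tuple_def)
  qed
  have "proper_filter_in I D V"
    unfolding proper_filter_in_def
  proof (intro conjI ballI impI)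
    show "V \<subseteq> max_set_product I D" by (auto simp: V_def)
    show "V \<noteq> {}"
      using vanishing_mem additive_subgroup.zero_closed[OF is_additive_subgroup] by blast
    show "(\<lambda>i\<in>I. {}) \<notin> V" using proper by (fastforce simp: V_def)
  next
    fix Y Z assume "Y \<in> V" "Z \<in> V"
    then obtain J K where "adm J" "\<forall>i\<in>I. locus J i \<subseteq> Y i" "adm K" "\<forall>i\<in>I. locus K i \<subseteq> Z i"
      and YZ: "Y \<in> max_set_product I D"
      by (auto simp: V_def)
    \<comment> \<open>The sum family witnesses that the meet belongs to \<open>V\<close>.\<close>
    then have "adm (\<lambda>i. J i <+>\<^bsub>D i\<^esub> K i) \<and>
        (\<forall>i\<in>I. locus (\<lambda>i. J i <+>\<^bsub>D i\<^esub> K i) i \<subseteq> (\<lambda>i\<in>I. Y i \<inter> Z i) i)"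
      using sum locus_sum by fastforce
    moreover have "(\<lambda>i\<in>I. Y i \<inter> Z i) \<in> max_set_product I D"
      using YZ by (auto simp: max_set_product_def)
    ultimately show "(\<lambda>i\<in>I. Y i \<inter> Z i) \<in> V" unfolding V_def by blast
  next
    fix Y Z assume "Y \<in> V" "Z \<in> max_set_product I D" "\<forall>i\<in>I. Y i \<subseteq> Z i"
    then show "Z \<in> V" unfolding V_def by blast
  qed
  then obtain U where "ultrafilter_in I D U" "V \<subseteq> U"
    using ex_ultrafilter_in_above by blast
  moreover from this have "P \<subseteq> ultrafilter_ideal I D U"
    using vanishing_mem Icarr unfolding ultrafilter_ideal_def by blast
  ultimately show ?thesis by blast
qed

end

theorem proposition2p30:
  fixes I :: "'i set" and D :: "'i \<Rightarrow> ('a, 'm) ring_scheme"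
  assumes "\<And>i. i \<in> I \<Longrightarrow> domain (D i)"
  shows "(\<forall>P. primeideal P (product_ring I D) \<longrightarrow>
           (\<exists>U. ultrafilter_in I D U \<and> P \<subseteq> ultrafilter_ideal I D U)) \<and>
         (\<forall>P. primeideal P (product_ring I D) \<longrightarrow>
           (\<exists>!Q. minimal_primeideal Q (product_ring I D) \<and> Q \<subseteq> P) \<and>
           (\<forall>Q U. minimal_primeideal Q (product_ring I D) \<and> Q \<subseteq> P \<and>
              ultrafilter_in I D U \<and> P \<subseteq> ultrafilter_ideal I D U \<longrightarrow>
              Q = zero_filter_ideal I D (index_filter I U))) \<and>
         (\<forall>P. primeideal P (product_ring I D) \<longrightarrow>
           (\<exists>U. ultrafilter_in I D U \<and>
              zero_filter_ideal I D (index_filter I U) \<subseteq> P \<and>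
              P \<subseteq> ultrafilter_ideal I D U))"
proof -
  interpret domain_family I D by (rule domain_family.intro) (rule assms)
  \<comment> \<open>All ultrafilters above \<open>P\<close> share the index filter
    \<open>F P\<close>, so the resulting ideal does not depend on the choice of
    \<open>U\<close>.\<close>
  have index: "index_filter I U = F P"
    if "primeideal P R" "ultrafilter_in I D U" "P \<subseteq> ultrafilter_ideal I D U" for P U
    using index_filter_eq that by (auto simp: ultrafilter_in_def)
  have unique: "\<exists>!Q. minimal_primeideal Q R \<and> Q \<subseteq> P" if "primeideal P R" for P
    using minimal_primeideal_below_iff[OF that] by simp
  have eq: "Q = zero_filter_ideal I D (index_filter I U)"
    if "primeideal P R" "minimal_primeideal Q R \<and> Q \<subseteq> P \<and>
      ultrafilter_in I D U \<and> P \<subseteq> ultrafilter_ideal I D U" for P Q U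
    using minimal_primeideal_below_iff[OF that(1)] index[OF that(1)] that(2) by metis
  have between: "\<exists>U. ultrafilter_in I D U \<and> zero_filter_ideal I D (index_filter I U) \<subseteq> P \<and>
      P \<subseteq> ultrafilter_ideal I D U" if "primeideal P R" for P
    using ex_ultrafilter_ideal_above[OF that] index[OF that]
      zero_filter_ideal_subset_prime[OF that] by metis
  show ?thesis
    by (intro conjI allI impI) (rule ex_ultrafilter_ideal_above unique eq between; assumption)+
qed

end
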